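(* Let $m \ge 2$ and $n\ge 1$ be integers and let $\Gamma \subset \mathbb{P}^n$ be a finite set of $d$ points in linearly general position. If $d \leq mn$, then $$I(\Gamma) = \langle I(\Gamma)_{\leq m-1},\ \Phi(\Gamma)_m \rangle ,$$ i.e. the homogeneous ideal $I(\Gamma)$ is generated, as an ideal, by all its homogeneous elements of degree at most $m-1$ together with all elements of $\Phi(\Gamma)_m$. In particular, $I(\Gamma)$ is generated by forms of degree $\leq m$.
   Context: $k$ is an algebraically closed field of arbitrary characteristic, $\mathbb{P}^n$ is projective $n$-space over $k$, and $S = k[x_0,x_1,\ldots,x_n]$ is its homogeneous coordinate ring, with $S_\ell$ the space of forms of degree $\ell$. A finite set $\Gamma\subset\mathbb{P}^n$ is in linearly general position if any $n+1$ points of $\Gamma$ span $\mathbb{P}^n$; when $|\Gamma| \le n$ this is understood as: the points of $\Gamma$ are linearly independent (so in all cases every subset of at most $n+1$ points is linearly independent). $I(\Gamma)\subset S$ is the homogeneous ideal of all polynomials vanishing on $\Gamma$, $I(\Gamma)_\ell$ is its degree-$\ell$ piece, and $I(\Gamma)_{\le \ell}$ is the set of its homogeneous elements of degree at most $\ell$. For an integer $\ell\ge 1$, $\Phi(\Gamma)_\ell$ is the set of all completely decomposable polynomials in $I(\Gamma)_\ell$, i.e. $\Phi(\Gamma)_\ell = I(\Gamma)_\ell \cap \{h_1\cdots h_\ell \mid h_1,\ldots,h_\ell \in S_1\setminus\{0\}\}$. *)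

theory Defs
  imports "HOL-Analysis.Analysis" "HOL-Library.Poly_Mapping"
begin

text \<open>
  The coordinates of projective space are indexed by a finite type \<open>'v\<close>; for
  projective \<open>n\<close>-space one takes \<open>CARD('v) = n + 1\<close>.  A polynomial is a finitely supported
  map from monomials (exponent vectors) to coefficients, so that the whole type
  \<open>('k, 'v) mpoly\<close> is the homogeneous coordinate ring \<open>S\<close>.
\<close>

type_synonym ('k, 'v) mpoly = "('v \<Rightarrow>\<^sub>0 nat) \<Rightarrow>\<^sub>0 'k"

definition mpoly_eval :: "('k::comm_ring_1, 'v::finite) mpoly \<Rightarrow> 'k ^ 'v \<Rightarrow> 'k" where
  "mpoly_eval f v =
     (\<Sum>a\<in>Poly_Mapping.keys f. Poly_Mapping.lookup f a * (\<Prod>i\<in>UNIV. (v $ i) ^ Poly_Mapping.lookup a i))"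

text \<open>The space of forms of degree \<open>l\<close>, which contains the zero polynomial for every \<open>l\<close>.\<close>

definition forms :: "nat \<Rightarrow> ('k::comm_ring_1, 'v::finite) mpoly set" where
  "forms l = {f. \<forall>a\<in>Poly_Mapping.keys f. (\<Sum>i\<in>UNIV. Poly_Mapping.lookup a i) = l}"

text \<open>A commutative ring is a module over itself, and its ideals are the submodules.\<close>

lemma module_times: "module ((*) :: 'a::comm_ring_1 \<Rightarrow> 'a \<Rightarrow> 'a)"
  by unfold_locales (simp_all add: algebra_simps)

abbreviation ideal_generated :: "'a::comm_ring_1 set \<Rightarrow> 'a set" where
  "ideal_generated \<equiv> module.span (*)"

text \<open>
  A point of projective space is an equivalence class of nonzero vectors modulo nonzero
  scalars; the elements of the class are its representatives (the zero vector is not one).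
\<close>

definition proportional :: "(('k::field ^ 'v) \<times> ('k ^ 'v)) set" where
  "proportional = {(v, w). v \<noteq> 0 \<and> w \<noteq> 0 \<and> (\<exists>c. c \<noteq> 0 \<and> w = c *s v)}"

lemma equiv_proportional: "equiv {v. v \<noteq> 0} (proportional :: (('k::field ^ 'v) \<times> _) set)"
proof (rule equivI)
  show "proportional \<subseteq> {v. v \<noteq> 0} \<times> {v :: 'k ^ 'v. v \<noteq> 0}"
    by (auto simp: proportional_def)
  show "refl_on {v. v \<noteq> 0} (proportional :: (('k ^ 'v) \<times> _) set)"
    by (auto simp: refl_on_def proportional_def intro!: exI[of _ 1])
  show "sym (proportional :: (('k ^ 'v) \<times> _) set)"
  proof (rule symI)
    fix v w :: "'k ^ 'v"
    assume "(v, w) \<in> proportional"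
    then obtain c where "v \<noteq> 0" "w \<noteq> 0" "c \<noteq> 0" "w = c *s v"
      by (auto simp: proportional_def)
    moreover from this have "v = inverse c *s w"
      by (simp add: vector_smult_assoc)
    ultimately show "(w, v) \<in> proportional"
      unfolding proportional_def by (force intro!: exI[of _ "inverse c"])
  qed
  show "trans (proportional :: (('k ^ 'v) \<times> _) set)"
  proof (rule transI)
    fix u v w :: "'k ^ 'v"
    assume "(u, v) \<in> proportional" "(v, w) \<in> proportional"
    then obtain b c where "u \<noteq> 0" "w \<noteq> 0" "b \<noteq> 0" "c \<noteq> 0" "w = (c * b) *s u"
      by (auto simp: proportional_def vector_smult_assoc)
    then show "(u, w) \<in> proportional"
      unfolding proportional_def by (force intro!: exI[of _ "c * b"])
  qed
qed

definition proj_space :: "('k::field ^ 'v) set set" where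
  "proj_space = {v. v \<noteq> 0} // proportional"

text \<open>
  Distinct points have distinct representatives, so a choice of representatives is injective
  and independence of its image is independence of the family.
\<close>

definition lin_indep_points :: "('k::field ^ 'v) set set \<Rightarrow> bool" where
  "lin_indep_points T \<longleftrightarrow> (\<forall>r. (\<forall>P\<in>T. r P \<in> P) \<longrightarrow> vec.independent (r ` T))"

definition lin_general_position :: "('k::field ^ 'v) set set \<Rightarrow> bool" where
  "lin_general_position \<Gamma> \<longleftrightarrow>
     (if CARD('v) \<le> card \<Gamma>
      then \<forall>T\<subseteq>\<Gamma>. card T = CARD('v) \<longrightarrow> vec.span (\<Union>T) = UNIV
      else lin_indep_points \<Gamma>)"

text \<open>
  A polynomial that need not be homogeneous vanishes at a point if it vanishes at all
  representatives of the point.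
\<close>

definition vanishing_ideal :: "('k::field ^ 'v) set set \<Rightarrow> ('k, 'v) mpoly set" where
  "vanishing_ideal \<Gamma> = {f. \<forall>P\<in>\<Gamma>. \<forall>v\<in>P. mpoly_eval f v = 0}"

definition vanishing_forms :: "('k::field ^ 'v) set set \<Rightarrow> nat \<Rightarrow> ('k, 'v) mpoly set" where
  "vanishing_forms \<Gamma> l = vanishing_ideal \<Gamma> \<inter> forms l"

definition vanishing_forms_upto :: "('k::field ^ 'v) set set \<Rightarrow> nat \<Rightarrow> ('k, 'v) mpoly set" where
  "vanishing_forms_upto \<Gamma> l = (\<Union>j\<le>l. vanishing_forms \<Gamma> j)"

definition decomposable_vanishing_forms ::
    "('k::field ^ 'v) set set \<Rightarrow> nat \<Rightarrow> ('k, 'v) mpoly set" where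
  "decomposable_vanishing_forms \<Gamma> l =
     vanishing_forms \<Gamma> l \<inter> {\<Prod>i<l. h i | h. \<forall>i<l. h i \<in> forms 1 - {0}}"

end

theory Submission imports Defs begin

text \<open>
  The points are replaced by a finite set \<open>V\<close> of representing vectors, any \<open>n + 1\<close> or fewer of
  which are independent, and their ideal by the ideal of all polynomials that vanish on the lines
  through \<open>V\<close> (without the origin).  Let \<open>J m V\<close>, which is
  \<open>generated_part V m\<close> below, be generated by the forms of degree less than \<open>m\<close> in that ideal and
  the products of \<open>m\<close> linear forms in it.

  The proof goes by induction on \<open>m\<close>, removing \<open>n\<close> points at a time.  If \<open>V\<close> has at most \<open>n\<close>
  points, they can be taken as coordinate points, and their ideal is generated by coordinates
  and products of two different coordinates (\<open>cone_ideal_independent\<close>).  Otherwise choose \<open>n\<close>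
  points \<open>A\<close> of \<open>V\<close> and the hyperplane \<open>h\<close> through them; no other point lies on it.

  First, \<open>h\<close> times the ideal of \<open>V - A\<close> is contained in \<open>J m V\<close>, whatever \<open>A\<close> is: for
  \<open>m > 2\<close> this is the induction hypothesis for \<open>V - A\<close> and \<open>m - 1\<close>, since \<open>h\<close> times a
  generator is a generator (\<open>linear_multiple_mem_generated_part\<close>); \<open>m = 2\<close> needs its own
  argument (\<open>hyperplane_multiple_two\<close>).

  Secondly, in degrees at least \<open>m\<close>, an element \<open>f\<close> of the ideal of \<open>V\<close> is congruent modulo \<open>h\<close> to
  an element of \<open>J m V\<close> (\<open>cone_ideal_by_hyperplane_multiples\<close>).  Restricted to the hyperplane,
  the points \<open>A\<close> are coordinate points, so it is enough to obtain the products \<open>x * g\<close> where \<open>x\<close> is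
  the coordinate of \<open>b \<in> A\<close> and \<open>g\<close> has degree \<open>m - 1\<close> and vanishes at \<open>b\<close>.  The form \<open>x\<close> extends to
  a hyperplane through \<open>A - {b}\<close> and any prescribed point \<open>v\<close> of \<open>V - A\<close>; so by the first step
  \<open>x * g\<close> is obtained if \<open>g\<close> vanishes on the remaining points of \<open>V - A\<close>.  Such forms \<open>g\<close>, with
  varying \<open>v\<close>, span all forms of degree \<open>m - 1\<close> that vanish at \<open>b\<close>, because the at most
  \<open>(m - 1) * n + 1\<close> points concerned impose independent conditions on forms of this degree
  (\<open>form_separator\<close>).

  Finally, if \<open>f - h * r\<close> is in \<open>J m V\<close>, then \<open>h * r\<close> vanishes on \<open>V\<close>, hence \<open>r\<close> vanishes on \<open>V - A\<close>,
  and \<open>h * r\<close> is in \<open>J m V\<close> by the first step.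
\<close>

section \<open>Evaluation and homogeneous components\<close>

abbreviation const :: "'k \<Rightarrow> ('k::comm_ring_1, 'v::finite) mpoly" where
  "const \<equiv> Poly_Mapping.single 0"

abbreviation total_degree :: "('v::finite \<Rightarrow>\<^sub>0 nat) \<Rightarrow> nat" where
  "total_degree a \<equiv> (\<Sum>i\<in>UNIV. Poly_Mapping.lookup a i)"

abbreviation monom_eval :: "('v::finite \<Rightarrow>\<^sub>0 nat) \<Rightarrow> 'k::comm_ring_1 ^ 'v \<Rightarrow> 'k" where
  "monom_eval a v \<equiv> (\<Prod>i\<in>UNIV. (v $ i) ^ Poly_Mapping.lookup a i)"

lemma sum_of_terms: "f = (\<Sum>a\<in>Poly_Mapping.keys f. Poly_Mapping.single a (Poly_Mapping.lookup f a))"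
  by (rule poly_mapping_eqI) (simp add: lookup_sum lookup_single when_def in_keys_iff)

lemma mpoly_eval_superset:
  assumes "finite S" "Poly_Mapping.keys f \<subseteq> S"
  shows "mpoly_eval f v = (\<Sum>a\<in>S. Poly_Mapping.lookup f a * monom_eval a v)"
  unfolding mpoly_eval_def
  by (rule sum.mono_neutral_left) (use assms in \<open>auto simp: in_keys_iff\<close>)

lemma mpoly_eval_zero [simp]: "mpoly_eval 0 v = 0"
  by (simp add: mpoly_eval_def)

lemma mpoly_eval_single [simp]: "mpoly_eval (Poly_Mapping.single a c) v = c * monom_eval a v"
  by (subst mpoly_eval_superset[of "{a}"]) auto

lemma mpoly_eval_add [simp]: "mpoly_eval (f + g) v = mpoly_eval f v + mpoly_eval g v"
proof -
  let ?S = "Poly_Mapping.keys f \<union> Poly_Mapping.keys g"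
  have "Poly_Mapping.keys (f + g) \<subseteq> ?S" by (rule keys_add)
  then show ?thesis
    by (simp add: mpoly_eval_superset[of ?S] lookup_add distrib_right sum.distrib)
qed

lemma mpoly_eval_diff [simp]: "mpoly_eval (f - g) v = mpoly_eval f v - mpoly_eval g v"
  using mpoly_eval_add[of "f - g" g v] by (simp add: algebra_simps)

lemma mpoly_eval_sum [simp]: "mpoly_eval (sum F I) v = (\<Sum>i\<in>I. mpoly_eval (F i) v)"
  by (induction I rule: infinite_finite_induct) auto

lemma mpoly_eval_mult [simp]: "mpoly_eval (f * g) v = mpoly_eval f v * mpoly_eval g v"
proof -
  have "f * g = (\<Sum>a\<in>Poly_Mapping.keys f. \<Sum>b\<in>Poly_Mapping.keys g.
      Poly_Mapping.single (a + b) (Poly_Mapping.lookup f a * Poly_Mapping.lookup g b))"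
    by (subst sum_of_terms[of f], subst sum_of_terms[of g]) (simp add: sum_product mult_single)
  then have "mpoly_eval (f * g) v = (\<Sum>a\<in>Poly_Mapping.keys f. \<Sum>b\<in>Poly_Mapping.keys g.
      (Poly_Mapping.lookup f a * monom_eval a v) * (Poly_Mapping.lookup g b * monom_eval b v))"
    by (simp add: lookup_add power_add prod.distrib mult_ac)
  also have "\<dots> = mpoly_eval f v * mpoly_eval g v"
    by (simp add: mpoly_eval_def sum_product)
  finally show ?thesis .
qed

lemma mpoly_eval_one [simp]: "mpoly_eval 1 v = 1"
  by (simp flip: single_one)

lemma mpoly_eval_prod [simp]: "mpoly_eval (prod F I) v = (\<Prod>i\<in>I. mpoly_eval (F i) v)"
  by (induction I rule: infinite_finite_induct) auto

lemma forms_zero [simp]: "0 \<in> forms l"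
  by (simp add: forms_def)

lemma forms_add [intro]: "f \<in> forms l \<Longrightarrow> g \<in> forms l \<Longrightarrow> f + g \<in> forms l"
  using keys_add[of f g] unfolding forms_def by blast

lemma forms_single: "total_degree a = l \<Longrightarrow> Poly_Mapping.single a c \<in> forms l"
  by (simp add: forms_def)

lemma forms_const [simp]: "const c \<in> forms 0"
  by (simp add: forms_single)

lemma forms_mult: "f \<in> forms k \<Longrightarrow> g \<in> forms l \<Longrightarrow> f * g \<in> forms (k + l)"
  using keys_mult[of f g] unfolding forms_def by (fastforce simp: lookup_add sum.distrib)

lemma forms_const_mult [intro]: "f \<in> forms l \<Longrightarrow> const c * f \<in> forms l"
  using forms_mult[OF forms_const] by fastforce

lemma forms_diff [intro]:
  assumes "f \<in> forms l" "g \<in> forms l"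
  shows "f - g \<in> forms l"
  using assms keys_diff[of f g] unfolding forms_def by blast

lemma forms_sum [intro]: "(\<And>i. i \<in> I \<Longrightarrow> F i \<in> forms l) \<Longrightarrow> sum F I \<in> forms l"
  by (induction I rule: infinite_finite_induct) auto

lemma forms_prod:
  assumes "finite I" "\<And>i. i \<in> I \<Longrightarrow> F i \<in> forms 1"
  shows "prod F I \<in> forms (card I)"
  using assms
proof (induction I rule: finite_induct)
  case empty
  then show ?case using forms_const[of 1] by simp
next
  case (insert i I)
  then show ?case using forms_mult[of "F i" 1 "prod F I" "card I"] by simp
qed

text \<open>
  A point is a whole class of vectors, but for a form it does not matter which of them is
  tested: this is what allows the geometry to be done with one representative per point.
\<close>

lemma mpoly_eval_scale_form:
  fixes f :: "('k::field, 'v::finite) mpoly"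
  assumes "f \<in> forms l"
  shows "mpoly_eval f (c *s v) = c ^ l * mpoly_eval f v"
proof -
  have "monom_eval a (c *s v) = c ^ l * monom_eval a v" if "a \<in> Poly_Mapping.keys f" for a
    using assms that by (auto simp: forms_def power_mult_distrib prod.distrib power_sum)
  then show ?thesis
    by (simp add: mpoly_eval_def sum_distrib_left mult_ac)
qed

lemma homogeneous_decomposition:
  fixes f :: "('k::field, 'v::finite) mpoly"
  obtains L F where "finite L" "f = (\<Sum>l\<in>L. F l)" "\<And>l. F l \<in> forms l"
proof
  let ?F = "\<lambda>l. \<Sum>a\<in>{a \<in> Poly_Mapping.keys f. total_degree a = l}.
    Poly_Mapping.single a (Poly_Mapping.lookup f a)"
  show "finite (total_degree ` Poly_Mapping.keys f)" by simp
  show "f = (\<Sum>l\<in>total_degree ` Poly_Mapping.keys f. ?F l)"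
    by (subst sum_of_terms, rule sum.image_gen) simp
  show "?F l \<in> forms l" for l
    by (auto intro: forms_single)
qed

section \<open>Linear forms and bases\<close>

definition lin_form :: "'k::field ^ 'v \<Rightarrow> ('k, 'v::finite) mpoly" where
  "lin_form w = (\<Sum>i\<in>UNIV. Poly_Mapping.single (Poly_Mapping.single i 1) (w $ i))"

lemma total_degree_single [simp]: "total_degree (Poly_Mapping.single i l) = l"
  by (simp add: lookup_single when_def)

lemma lin_form_in_forms [intro]: "lin_form w \<in> forms 1"
  unfolding lin_form_def by (intro forms_sum forms_single total_degree_single)

lemma monom_eval_single: "monom_eval (Poly_Mapping.single i 1) v = v $ i"
proof -
  have "monom_eval (Poly_Mapping.single i 1) v = (\<Prod>j\<in>UNIV. if j = i then v $ j else 1)"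
    by (intro prod.cong refl) (auto simp: lookup_single when_def)
  then show ?thesis by simp
qed

lemma mpoly_eval_lin_form: "mpoly_eval (lin_form w) v = (\<Sum>i\<in>UNIV. w $ i * v $ i)"
  unfolding lin_form_def mpoly_eval_sum mpoly_eval_single monom_eval_single ..

lemma total_degree_eq_1:
  assumes "total_degree a = 1"
  obtains i where "a = Poly_Mapping.single i 1"
proof -
  obtain i where i: "Poly_Mapping.lookup a i = 1" "\<forall>j. j \<noteq> i \<longrightarrow> Poly_Mapping.lookup a j = 0"
    using assms by (metis finite UNIV_I sum_eq_1_iff)
  then have "a = Poly_Mapping.single i 1"
    by (intro poly_mapping_eqI) (auto simp: lookup_single when_def)
  then show ?thesis by (rule that)
qed

lemma linear_form_cases:
  fixes f :: "('k::field, 'v::finite) mpoly"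
  assumes "f \<in> forms 1"
  obtains w where "f = lin_form w"
proof
  show "f = lin_form (\<chi> i. Poly_Mapping.lookup f (Poly_Mapping.single i 1))"
  proof (rule poly_mapping_eqI)
    fix a
    have eq: "Poly_Mapping.lookup (lin_form (\<chi> i. Poly_Mapping.lookup f (Poly_Mapping.single i 1))) a =
      (\<Sum>i\<in>UNIV. if Poly_Mapping.single i 1 = a
        then Poly_Mapping.lookup f (Poly_Mapping.single i 1) else 0)"
      by (simp add: lin_form_def lookup_sum lookup_single when_def del: One_nat_def)
    show "Poly_Mapping.lookup f a =
      Poly_Mapping.lookup (lin_form (\<chi> i. Poly_Mapping.lookup f (Poly_Mapping.single i 1))) a"
    proof (cases "total_degree a = 1")
      case True
      then obtain i where i: "a = Poly_Mapping.single i 1" by (rule total_degree_eq_1)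
      have "(Poly_Mapping.single j (1::nat) = Poly_Mapping.single i 1) \<longleftrightarrow> j = i" for j
        by (metis keys_single one_neq_zero singleton_inject)
      then show ?thesis unfolding eq unfolding i by simp
    next
      case False
      then have "Poly_Mapping.lookup f a = 0"
        using assms by (auto simp: forms_def in_keys_iff)
      moreover have "Poly_Mapping.single i 1 \<noteq> a" for i using False by auto
      ultimately show ?thesis unfolding eq by simp
    qed
  qed
qed

text \<open>
  Evaluation of a linear form is linear in the vector, so its zeros are a subspace; a
  linear form is determined by its values as soon as these are known on a spanning set.
\<close>

lemma linear_form_zero_if_zero_on_spanning_set:
  fixes f :: "('k::field, 'v::finite) mpoly"
  assumes "f \<in> forms 1" "vec.span B = UNIV" "\<And>b. b \<in> B \<Longrightarrow> mpoly_eval f b = 0"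
  shows "f = 0"
proof -
  obtain w where w: "f = lin_form w" using assms(1) by (rule linear_form_cases)
  have "vec.subspace {v. mpoly_eval f v = 0}"
    by (rule vec.subspaceI)
      (auto simp: w mpoly_eval_lin_form distrib_left sum.distrib mult.left_commute
        simp flip: sum_distrib_left)
  then have "vec.span B \<subseteq> {v. mpoly_eval f v = 0}"
    using assms(3) by (intro vec.span_minimal) auto
  then have "mpoly_eval f (axis i 1) = 0" for i using assms(2) by auto
  then have "w $ i = 0" for i by (simp add: w mpoly_eval_lin_form axis_def if_distrib cong: if_cong)
  then show ?thesis by (simp add: w lin_form_def)
qed

text \<open>
  For a basis \<open>B\<close> these are the coordinate forms with respect to \<open>B\<close>.  They replace a
  linear change of coordinates of the polynomial ring.
\<close>

definition dual_form :: "('k::field ^ 'v) set \<Rightarrow> 'k ^ 'v \<Rightarrow> ('k, 'v::finite) mpoly" where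
  "dual_form B b = lin_form (\<chi> i. vec.representation B (axis i 1) b)"

definition is_basis :: "('k::field ^ 'v::finite) set \<Rightarrow> bool" where
  "is_basis B \<longleftrightarrow> vec.independent B \<and> vec.span B = UNIV"

lemma dual_form_in_forms [simp, intro]: "dual_form B b \<in> forms 1"
  unfolding dual_form_def by (rule lin_form_in_forms)

lemmas dual_form_in_forms_Suc [simp, intro] = dual_form_in_forms[unfolded One_nat_def]

lemma is_basis_finite: "is_basis B \<Longrightarrow> finite B"
  unfolding is_basis_def using vec.finiteI_independent by blast

lemma mpoly_eval_dual_form:
  fixes B :: "('k::field ^ 'v::finite) set"
  assumes "is_basis B"
  shows "mpoly_eval (dual_form B b) v = vec.representation B v b"
proof -
  have ind: "vec.independent B" and sp: "u \<in> vec.span B" for u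
    using assms by (auto simp: is_basis_def)
  have "vec.representation B v b = vec.representation B (\<Sum>i\<in>UNIV. v $ i *s axis i 1) b"
    by (simp only: basis_expansion)
  also have "\<dots> = (\<Sum>i\<in>UNIV. v $ i * vec.representation B (axis i 1) b)"
    using ind sp by (simp add: vec.representation_sum vec.representation_scale)
  finally show ?thesis
    by (simp add: dual_form_def mpoly_eval_lin_form mult.commute)
qed

lemma mpoly_eval_dual_form_basis:
  assumes "is_basis B" "b \<in> B"
  shows "mpoly_eval (dual_form B a) b = (if a = b then 1 else 0)"
  using assms by (auto simp: mpoly_eval_dual_form is_basis_def vec.representation_basis)

lemma linear_form_expansion:
  fixes f :: "('k::field, 'v::finite) mpoly"
  assumes "is_basis B" "f \<in> forms 1"
  shows "f = (\<Sum>b\<in>B. const (mpoly_eval f b) * dual_form B b)"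
proof -
  let ?g = "\<Sum>b\<in>B. const (mpoly_eval f b) * dual_form B b"
  have "f - ?g = 0"
  proof (rule linear_form_zero_if_zero_on_spanning_set)
    show "f - ?g \<in> forms 1" using assms(2) by (intro forms_diff forms_sum forms_const_mult) auto
    show "vec.span B = UNIV" using assms(1) by (simp add: is_basis_def)
    show "mpoly_eval (f - ?g) b = 0" if "b \<in> B" for b
      using assms(1) that is_basis_finite[OF assms(1)]
      by (simp add: mpoly_eval_dual_form_basis if_distrib cong: if_cong)
  qed
  then show ?thesis by simp
qed

text \<open>
  Each variable is a combination of the dual forms of \<open>B\<close>, so every form of positive degree is
  a sum of multiples of these by forms of one degree less.
\<close>

lemma form_Suc_induct:
  fixes f :: "('k::field, 'v::finite) mpoly"
  assumes B: "is_basis B" and f: "f \<in> forms (Suc l)"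
    and zero: "P 0" and add: "\<And>f g :: ('k, 'v) mpoly. P f \<Longrightarrow> P g \<Longrightarrow> P (f + g)"
    and step: "\<And>b g. b \<in> B \<Longrightarrow> g \<in> forms l \<Longrightarrow> P (dual_form B b * g)"
  shows "P f"
proof -
  have sum: "P (sum F I)" if "\<And>i. i \<in> I \<Longrightarrow> P (F i)" for F :: "'c \<Rightarrow> _" and I
    using that by (induction I rule: infinite_finite_induct) (auto intro: zero add)
  have "P (Poly_Mapping.single a c)" if a: "total_degree a = Suc l" for a c
  proof -
    obtain i where i: "Poly_Mapping.lookup a i \<noteq> 0"
      using a by (metis nat.distinct(1) sum.neutral)
    define a' where "a' = a - Poly_Mapping.single i 1"
    have a': "a = Poly_Mapping.single i 1 + a'"
      by (rule poly_mapping_eqI)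
        (use i in \<open>auto simp: a'_def lookup_add lookup_minus lookup_single when_def\<close>)
    then have "total_degree a = total_degree (Poly_Mapping.single i (1::nat)) + total_degree a'"
      by (simp only: lookup_add sum.distrib)
    then have deg: "total_degree a' = l"
      using a by (simp only: total_degree_single)
    define x :: "('k, 'v) mpoly" where "x = Poly_Mapping.single (Poly_Mapping.single i 1) 1"
    have "x \<in> forms 1" unfolding x_def by (intro forms_single total_degree_single)
    have "Poly_Mapping.single a c = x * Poly_Mapping.single a' c"
      by (simp add: x_def mult_single a')
    also have "\<dots> = (\<Sum>b\<in>B. const (mpoly_eval x b) * dual_form B b) * Poly_Mapping.single a' c"
      using linear_form_expansion[OF B \<open>x \<in> forms 1\<close>] by simp
    also have "\<dots> = (\<Sum>b\<in>B. dual_form B b * (const (mpoly_eval x b) * Poly_Mapping.single a' c))"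
      by (simp add: sum_distrib_left sum_distrib_right mult_ac)
    finally have "Poly_Mapping.single a c = \<dots>" .
    moreover have "P \<dots>"
      by (intro sum step forms_const_mult forms_single deg)
    ultimately show ?thesis by simp
  qed
  then have "P (\<Sum>a\<in>Poly_Mapping.keys f. Poly_Mapping.single a (Poly_Mapping.lookup f a))"
    using f by (intro sum) (auto simp: forms_def)
  then show ?thesis by (simp flip: sum_of_terms)
qed

lemma forms_0_const:
  assumes "f \<in> forms 0"
  obtains c where "f = const c"
proof
  have "a = 0" if "a \<in> Poly_Mapping.keys f" for a
    using that assms by (auto simp: forms_def intro!: poly_mapping_eqI)
  then have "Poly_Mapping.keys f \<subseteq> {0}" by auto
  then show "f = const (Poly_Mapping.lookup f 0)"
    by (intro poly_mapping_eqI) (auto simp: lookup_single when_def in_keys_iff)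
qed

text \<open>
  Iterating the splitting of one linear factor shows that the words in the dual forms span
  each graded piece: they play the part of the monomials in coordinates adapted to \<open>B\<close>.
\<close>

lemma form_word_induct:
  fixes f :: "('k::field, 'v::finite) mpoly"
  assumes B: "is_basis B" and f: "f \<in> forms l"
    and zero: "P 0" and add: "\<And>f g :: ('k, 'v) mpoly. P f \<Longrightarrow> P g \<Longrightarrow> P (f + g)"
    and word: "\<And>c w. (\<And>i. i < l \<Longrightarrow> w i \<in> B) \<Longrightarrow> P (const c * (\<Prod>i<l. dual_form B (w i)))"
  shows "P f"
  using f zero add word
proof (induction l arbitrary: f P)
  case 0
  from 0(1) obtain c where "f = const c" by (rule forms_0_const)
  then show ?case using 0(4)[of _ c] by simp
next
  case (Suc l)
  note add = Suc.prems(3) and word = Suc.prems(4)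
  show ?case
  proof (rule form_Suc_induct[OF B Suc.prems(1), where P = P])
    fix b and g :: "('k, 'v) mpoly" assume b: "b \<in> B" and g: "g \<in> forms l"
    show "P (dual_form B b * g)"
    proof (rule Suc.IH[OF g, where P = "\<lambda>g. P (dual_form B b * g)"])
      show "P (dual_form B b * 0)" using Suc.prems(2) by simp
      show "P (dual_form B b * (f + g))" if "P (dual_form B b * f)" "P (dual_form B b * g)"
        for f g :: "('k, 'v) mpoly"
        using that by (simp add: distrib_left add)
      fix c w assume w: "\<And>i. i < l \<Longrightarrow> w i \<in> B"
      have "P (const c * (\<Prod>i<Suc l. dual_form B ((w(l := b)) i)))"
        by (rule word) (use w b in \<open>auto simp: less_Suc_eq\<close>)
      also have "(\<Prod>i<Suc l. dual_form B ((w(l := b)) i)) = dual_form B b * (\<Prod>i<l. dual_form B (w i))"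
        by (simp add: mult.commute)
      finally show "P (dual_form B b * (const c * (\<Prod>i<l. dual_form B (w i))))"
        by (simp add: mult_ac)
    qed
  qed (use Suc.prems(2) add in auto)
qed

section \<open>Ideals of finite sets of lines through the origin\<close>

interpretation ideal: module "(*) :: 'a::comm_ring_1 \<Rightarrow> 'a \<Rightarrow> 'a"
  by (rule module_times)

(* Here scalar multiplication is the ring multiplication itself; reassociating to the left
   would loop together with the usual rewriting by associativity and commutativity. *)
declare ideal.scale_scale [simp del]

lemma ideal_subspace_vimage_mult:
  assumes "ideal.subspace K"
  shows "ideal.subspace {f. h * f \<in> K}"
proof (rule ideal.subspaceI)
  show "0 \<in> {f. h * f \<in> K}" using ideal.subspace_0[OF assms] by simp
  show "f + g \<in> {f. h * f \<in> K}" if "f \<in> {f. h * f \<in> K}" "g \<in> {f. h * f \<in> K}" for f g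
    using ideal.subspace_add[OF assms] that by (simp add: distrib_left)
  show "c * f \<in> {f. h * f \<in> K}" if "f \<in> {f. h * f \<in> K}" for c f
    using ideal.subspace_scale[OF assms, of "h * f" c] that by (simp add: mult.left_commute)
qed

text \<open>
  A membership that is known for all cofactors of one degree extends to all higher degrees,
  because forms of higher degree are sums of multiples of forms of that degree.
\<close>

lemma form_multiples_mem_ideal_mono:
  fixes u :: "('k::field, 'v::finite) mpoly" and B :: "('k ^ 'v) set"
  assumes B: "is_basis B" and K: "ideal.subspace K"
    and k: "\<And>q. q \<in> forms k \<Longrightarrow> u * q \<in> K" and "k \<le> l" "q \<in> forms l"
  shows "u * q \<in> K"
  using \<open>k \<le> l\<close> \<open>q \<in> forms l\<close>
proof (induction l arbitrary: q rule: dec_induct)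
  case base
  then show ?case by (rule k)
next
  case (step l)
  show ?case
  proof (rule form_Suc_induct[OF B step.prems, where P = "\<lambda>q. u * q \<in> K"])
    fix b and g :: "('k, 'v) mpoly" assume "g \<in> forms l"
    then have "dual_form B b * (u * g) \<in> K"
      by (intro ideal.subspace_scale[OF K] step.IH)
    then show "u * (dual_form B b * g) \<in> K" by (simp add: mult.left_commute)
  qed (auto simp: distrib_left ideal.subspace_0[OF K] intro: ideal.subspace_add[OF K])
qed

text \<open>
  A word in the dual forms is either a pure power or contains two different letters.  The
  second kind lies in \<open>K\<close> and vanishes on the basis; so the coefficient of the power of
  the dual form of \<open>b\<close> in \<open>f\<close> is the value of \<open>f\<close> at \<open>b\<close>, and only the basis vectors
  where \<open>f\<close> does not vanish leave anything to check.
\<close>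

lemma form_mem_ideal_of_mixed_products:
  fixes f :: "('k::field, 'v::finite) mpoly"
  assumes B: "is_basis B" and K: "ideal.subspace K" and f: "f \<in> forms l" and "l \<ge> 1"
    and mixed: "\<And>a b q. a \<in> B \<Longrightarrow> b \<in> B \<Longrightarrow> a \<noteq> b \<Longrightarrow> q \<in> forms (l - 2) \<Longrightarrow>
      dual_form B a * dual_form B b * q \<in> K"
    and pure: "\<And>b. b \<in> B \<Longrightarrow> mpoly_eval f b \<noteq> 0 \<Longrightarrow> dual_form B b \<in> K"
  shows "f \<in> K"
proof -
  \<comment> \<open>the part of \<open>g\<close> spanned by pure powers\<close>
  define D where "D g = (\<Sum>b\<in>B. const (mpoly_eval g b) * dual_form B b ^ l)" for g
  have fin: "finite B" using B by (rule is_basis_finite)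
  have D_add: "D (g + h) = D g + D h" for g h
    by (simp add: D_def single_add distrib_right sum.distrib)
  have "f - D f \<in> K"
  proof (rule form_word_induct[OF B f, where P = "\<lambda>f. f - D f \<in> K"])
    show "0 - D 0 \<in> K" using ideal.subspace_0[OF K] by (simp add: D_def)
    show "g + h - D (g + h) \<in> K" if "g - D g \<in> K" "h - D h \<in> K" for g h
      using ideal.subspace_add[OF K that] by (simp add: D_add algebra_simps)
    fix c w assume w: "\<And>i. i < l \<Longrightarrow> w i \<in> B"
    let ?f = "const c * (\<Prod>i<l. dual_form B (w i))"
    have ev: "mpoly_eval ?f b = c * (\<Prod>i<l. if w i = b then 1 else 0)" if "b \<in> B" for b
      using B that by (simp add: mpoly_eval_dual_form_basis)
    show "?f - D ?f \<in> K"
    proof (cases "\<forall>i<l. w i = w 0")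
      case True
      have const_word: "(\<Prod>i<l. F (w i)) = F (w 0) ^ l" for F :: "'k ^ 'v \<Rightarrow> 'c::comm_monoid_mult"
      proof -
        have "(\<Prod>i<l. F (w i)) = (\<Prod>i<l. F (w 0))"
          by (intro prod.cong refl arg_cong[where f = F]) (use True in blast)
        then show ?thesis by simp
      qed
      have "mpoly_eval ?f b = (if b = w 0 then c else 0)" if "b \<in> B" for b
        unfolding ev[OF that] const_word[of "\<lambda>a. if a = b then 1 else 0"]
        using \<open>l \<ge> 1\<close> by (simp add: power_0_left)
      then have "D ?f = (\<Sum>b\<in>B. if b = w 0 then const c * dual_form B b ^ l else 0)"
        unfolding D_def by (intro sum.cong) auto
      also have "\<dots> = const c * dual_form B (w 0) ^ l"
        using w[of 0] \<open>l \<ge> 1\<close> fin by simp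
      also have "dual_form B (w 0) ^ l = (\<Prod>i<l. dual_form B (w i))"
        by (rule const_word[symmetric])
      finally show ?thesis using ideal.subspace_0[OF K] by simp
    next
      case False
      then obtain i where i: "i < l" "w i \<noteq> w 0" by blast
      then have "i \<noteq> 0" by metis
      have "\<exists>j<l. w j \<noteq> b" for b using i \<open>l \<ge> 1\<close> by (cases "w i = b") (auto intro: exI[of _ 0])
      then have ev0: "mpoly_eval ?f b = 0" if "b \<in> B" for b
        unfolding ev[OF that] by auto
      have "D ?f = 0"
        unfolding D_def by (intro sum.neutral ballI) (simp only: ev0 single_zero mult_zero_left)
      moreover have "?f \<in> K"
      proof -
        let ?q = "\<Prod>j\<in>{..<l} - {0, i}. dual_form B (w j)"
        have "{..<l} = insert 0 (insert i ({..<l} - {0, i}))" using i by auto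
        then have "(\<Prod>j<l. dual_form B (w j)) =
            (\<Prod>j\<in>insert 0 (insert i ({..<l} - {0, i})). dual_form B (w j))" by simp
        also have "\<dots> = dual_form B (w 0) * dual_form B (w i) * ?q"
          using \<open>i \<noteq> 0\<close> by (simp add: mult.assoc)
        finally have eq: "(\<Prod>j<l. dual_form B (w j)) = dual_form B (w 0) * dual_form B (w i) * ?q" .
        have "card ({..<l} - {0, i}) = l - 2"
          using i \<open>i \<noteq> 0\<close> by (subst card_Diff_subset) auto
        then have "?q \<in> forms (l - 2)"
          using forms_prod[of "{..<l} - {0, i}" "\<lambda>j. dual_form B (w j)"] by simp
        then have "dual_form B (w 0) * dual_form B (w i) * ?q \<in> K"
          using i by (intro mixed w) auto
        then show ?thesis unfolding eq by (rule ideal.subspace_scale[OF K])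
      qed
      ultimately show ?thesis by simp
    qed
  qed
  moreover have "D f \<in> K"
    unfolding D_def
  proof (rule ideal.subspace_sum[OF K])
    fix b assume "b \<in> B"
    show "const (mpoly_eval f b) * dual_form B b ^ l \<in> K"
    proof (cases "mpoly_eval f b = 0")
      case True
      then show ?thesis using ideal.subspace_0[OF K] by simp
    next
      case False
      then have "const (mpoly_eval f b) * dual_form B b ^ (l - 1) * dual_form B b \<in> K"
        using pure[OF \<open>b \<in> B\<close>] by (intro ideal.subspace_scale[OF K])
      then show ?thesis using \<open>l \<ge> 1\<close> by (simp add: power_eq_if mult_ac)
    qed
  qed
  ultimately show ?thesis using ideal.subspace_add[OF K, of "f - D f" "D f"] by simp
qed

text \<open>
  The origin is left out so that this is exactly vanishing at all representatives of the points
  spanned by \<open>V\<close>, also for polynomials that are not homogeneous.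
\<close>

definition cone_ideal :: "('k::field ^ 'v) set \<Rightarrow> ('k, 'v::finite) mpoly set" where
  "cone_ideal V = {f. \<forall>v\<in>V. \<forall>c. c \<noteq> 0 \<longrightarrow> mpoly_eval f (c *s v) = 0}"

lemma form_mem_cone_ideal_iff:
  assumes "f \<in> forms l"
  shows "f \<in> cone_ideal V \<longleftrightarrow> (\<forall>v\<in>V. mpoly_eval f v = 0)"
  unfolding cone_ideal_def mem_Collect_eq mpoly_eval_scale_form[OF assms]
  by (auto intro: exI[of _ 1])

lemma subspace_cone_ideal: "ideal.subspace (cone_ideal V)"
  by (rule ideal.subspaceI) (auto simp: cone_ideal_def)

definition generating_forms :: "('k::field ^ 'v) set \<Rightarrow> nat \<Rightarrow> ('k, 'v::finite) mpoly set" where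
  "generating_forms V m = (\<Union>j\<le>m - 1. cone_ideal V \<inter> forms j) \<union>
     (cone_ideal V \<inter> forms m \<inter> {\<Prod>i<m. h i | h. \<forall>i<m. h i \<in> forms 1 - {0}})"

abbreviation generated_part :: "('k::field ^ 'v) set \<Rightarrow> nat \<Rightarrow> ('k, 'v::finite) mpoly set" where
  "generated_part V m \<equiv> ideal_generated (generating_forms V m)"

lemma generated_part_subset: "generated_part V m \<subseteq> cone_ideal V"
  by (rule ideal.span_minimal[OF _ subspace_cone_ideal]) (auto simp: generating_forms_def)

lemma low_degree_mem_generated_part:
  "f \<in> cone_ideal V \<Longrightarrow> f \<in> forms j \<Longrightarrow> j < m \<Longrightarrow> f \<in> generated_part V m"
  by (rule ideal.span_base) (auto simp: generating_forms_def)

text \<open>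
  This step raises \<open>m\<close> by one: multiplication by a linear form that vanishes on \<open>A\<close> turns the
  generators for \<open>V - A\<close>, of low degree or decomposable, into generators for \<open>V\<close>
  of the same kind.
\<close>

lemma linear_multiple_mem_generated_part:
  fixes V :: "('k::field ^ 'v::finite) set"
  assumes "m \<ge> 2" and h: "h \<in> forms 1" "\<And>v. v \<in> A \<Longrightarrow> mpoly_eval h v = 0"
    and f: "f \<in> generated_part (V - A) (m - 1)"
  shows "h * f \<in> generated_part V m"
proof (cases "h = 0")
  case True
  then show ?thesis using ideal.span_zero by simp
next
  case False
  have cone: "h * g \<in> cone_ideal V" if "g \<in> cone_ideal (V - A)" for g
    using that h(2) unfolding cone_ideal_def by (auto simp: mpoly_eval_scale_form[OF h(1)])
  have "generating_forms (V - A) (m - 1) \<subseteq> {f. h * f \<in> generated_part V m}"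
  proof
    fix g assume "g \<in> generating_forms (V - A) (m - 1)"
    then consider j where "j \<le> m - 1 - 1" "g \<in> cone_ideal (V - A)" "g \<in> forms j"
      | t where "g \<in> cone_ideal (V - A)" "g \<in> forms (m - 1)" "g = (\<Prod>i<m - 1. t i)"
          "\<forall>i<m - 1. t i \<in> forms 1 - {0}"
      unfolding generating_forms_def by auto
    then have "h * g \<in> generated_part V m"
    proof cases
      case 1
      then show ?thesis
        using cone forms_mult[OF h(1), of g j] \<open>m \<ge> 2\<close>
        by (intro low_degree_mem_generated_part) auto
    next
      case 2
      obtain m' where m: "m = Suc m'" using \<open>m \<ge> 2\<close> by (cases m) auto
      let ?s = "t(m' := h)"
      have "h * g = (\<Prod>i<m. ?s i)" using 2 by (simp add: m mult.commute)
      moreover have "\<forall>i<m. ?s i \<in> forms 1 - {0}"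
        using 2 h(1) False by (auto simp: m less_Suc_eq)
      moreover have "h * g \<in> cone_ideal V \<inter> forms m"
        using cone 2 forms_mult[OF h(1), of g m'] by (auto simp: m)
      ultimately have "h * g \<in> generating_forms V m"
        unfolding generating_forms_def by blast
      then show ?thesis by (rule ideal.span_base)
    qed
    then show "g \<in> {f. h * f \<in> generated_part V m}" by simp
  qed
  then have "generated_part (V - A) (m - 1) \<subseteq> {f. h * f \<in> generated_part V m}"
    by (intro ideal.span_minimal ideal_subspace_vimage_mult ideal.subspace_span)
  then show ?thesis using f by auto
qed

text \<open>
  Along the line through \<open>v\<close> a polynomial \<open>f\<close> becomes a polynomial in the scaling factor,
  whose coefficients are the values at \<open>v\<close> of the homogeneous components of \<open>f\<close>.  Over an
  infinite field it vanishes at all nonzero factors only if each component vanishes.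
\<close>

lemma cone_ideal_subset_if_forms:
  fixes V :: "('k::field ^ 'v::finite) set"
  assumes inf: "infinite (UNIV :: 'k set)" and K: "ideal.subspace K"
    and forms: "\<And>f l. f \<in> cone_ideal V \<Longrightarrow> f \<in> forms l \<Longrightarrow> f \<in> K"
  shows "cone_ideal V \<subseteq> K"
proof
  fix f assume f: "f \<in> cone_ideal V"
  obtain L F where L: "finite L" "f = (\<Sum>l\<in>L. F l)" and F: "\<And>l. F l \<in> forms l"
    using homogeneous_decomposition by blast
  have "F l \<in> cone_ideal V" if "l \<in> L" for l
    unfolding form_mem_cone_ideal_iff[OF F]
  proof
    fix v assume "v \<in> V"
    define p where "p = (\<Sum>l\<in>L. Polynomial.monom (mpoly_eval (F l) v) l)"
    have "poly p c = 0" if "c \<noteq> 0" for c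
    proof -
      have "poly p c = mpoly_eval f (c *s v)"
        by (simp add: p_def L(2) poly_sum poly_monom mpoly_eval_scale_form[OF F] mult.commute)
      then show ?thesis using f \<open>v \<in> V\<close> that by (simp add: cone_ideal_def)
    qed
    then have "UNIV - {0} \<subseteq> {c. poly p c = 0}" by auto
    moreover have "infinite (UNIV - {0::'k})" using inf by simp
    ultimately have "p = 0" using poly_roots_finite finite_subset by metis
    moreover have "poly.coeff p l = mpoly_eval (F l) v"
      using L(1) that by (simp add: p_def coeff_sum)
    ultimately show "mpoly_eval (F l) v = 0" by simp
  qed
  then show "f \<in> K" unfolding L(2) using forms F by (intro ideal.subspace_sum[OF K]) blast
qed

text \<open>
  Over a finite field, one plus the product of all \<open>X - a\<close> has positive degree and no root.
\<close>

lemma infinite_alg_closed_field: "infinite (UNIV :: 'k::alg_closed_field set)"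
proof
  assume fin: "finite (UNIV :: 'k set)"
  define p :: "'k poly" where "p = (\<Prod>a\<in>UNIV. [:-a, 1:]) + 1"
  have "degree (\<Prod>a\<in>(UNIV :: 'k set). [:-a, 1:]) = card (UNIV :: 'k set)"
    by (subst degree_prod_eq_sum_degree) auto
  moreover have "card (UNIV :: 'k set) > 0" using fin by (simp add: card_gt_0_iff)
  ultimately have "degree p > 0" unfolding p_def by (subst degree_add_eq_left) auto
  then obtain x where "poly p x = 0" using alg_closed_imp_poly_has_root by blast
  moreover have "poly p x = 1"
    using fin by (simp add: p_def poly_prod prod_zero_iff)
  ultimately show False by simp
qed

section \<open>Points in general position\<close>

text \<open>
  Independence of every small subset is the form of the condition that passes to subsets,
  and the induction on \<open>m\<close> needs this.
\<close>

definition general_position :: "('k::field ^ 'v::finite) set \<Rightarrow> bool" where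
  "general_position V \<longleftrightarrow>
     finite V \<and> (\<forall>T\<subseteq>V. card T \<le> CARD('v) \<longrightarrow> vec.independent T)"

lemma general_position_subset: "general_position V \<Longrightarrow> W \<subseteq> V \<Longrightarrow> general_position W"
  unfolding general_position_def using finite_subset by blast

lemma general_position_finite: "general_position V \<Longrightarrow> finite V"
  by (simp add: general_position_def)

lemma general_position_independent:
  fixes V :: "('k::field ^ 'v::finite) set"
  shows "general_position V \<Longrightarrow> T \<subseteq> V \<Longrightarrow> card T \<le> CARD('v) \<Longrightarrow> vec.independent T"
  by (simp add: general_position_def)

lemma is_basis_if_card:
  fixes B :: "('k::field ^ 'v::finite) set"
  assumes "vec.independent B" "card B = CARD('v)"
  shows "is_basis B"
  unfolding is_basis_def using assms vec.card_ge_dim_independent[of B UNIV, unfolded vec_dim_card] by auto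

lemma extend_basis_is_basis: "vec.independent T \<Longrightarrow> is_basis (vec.extend_basis T)"
  by (simp add: is_basis_def vec.independent_extend_basis vec.span_extend_basis)

lemma linear_separator:
  fixes T :: "('k::field ^ 'v::finite) set"
  assumes "vec.independent T" "p \<in> T"
  obtains h where "h \<in> forms 1" "mpoly_eval h p = 1" "\<And>v. v \<in> T - {p} \<Longrightarrow> mpoly_eval h v = 0"
proof
  let ?B = "vec.extend_basis T"
  have B: "is_basis ?B" "T \<subseteq> ?B"
    using assms by (auto intro: extend_basis_is_basis dest: vec.extend_basis_superset)
  show "dual_form ?B p \<in> forms 1" by simp
  show "mpoly_eval (dual_form ?B p) p = 1"
    using B assms(2) by (auto simp: mpoly_eval_dual_form_basis)
  show "mpoly_eval (dual_form ?B p) v = 0" if "v \<in> T - {p}" for v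
    using B that by (auto simp: mpoly_eval_dual_form_basis)
qed

text \<open>
  The points different from \<open>p\<close> are covered by \<open>k\<close> groups of at most \<open>n\<close> points.  By general
  position each group lies on a hyperplane that avoids \<open>p\<close>, and the product of these
  hyperplanes separates \<open>p\<close>.  In other words, up to \<open>k * n + 1\<close> points impose independent
  conditions on forms of degree \<open>k\<close>.
\<close>

lemma form_separator:
  fixes V :: "('k::field ^ 'v::finite) set"
  assumes "CARD('v) = n + 1" "general_position V" "p \<in> V" "card V \<le> k * n + 1"
  shows "\<exists>g\<in>forms k. mpoly_eval g p = 1 \<and> (\<forall>v\<in>V - {p}. mpoly_eval g v = 0)"
  using assms(2-4)
proof (induction k arbitrary: V)
  case 0
  then have "card (V - {p}) = 0" using general_position_finite by (simp add: card_Diff_singleton)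
  then have "V - {p} = {}" using 0 general_position_finite by (metis card_0_eq finite_Diff)
  then show ?case using forms_const[of 1] by (intro bexI[of _ 1]) auto
next
  case (Suc k)
  have fin: "finite V" using Suc.prems(1) by (rule general_position_finite)
  obtain A where A: "A \<subseteq> V - {p}" "card A = min n (card (V - {p}))"
    by (metis min.cobounded2 obtain_subset_with_card_n)
  have finA: "finite A" using A(1) fin finite_subset by blast
  have "p \<notin> A" using A(1) by blast
  have "vec.independent (insert p A)"
    by (rule general_position_independent[OF Suc.prems(1)])
      (use A Suc.prems(2) finA \<open>p \<notin> A\<close> assms(1) in auto)
  then obtain h where h: "h \<in> forms 1" "mpoly_eval h p = 1"
      "\<And>v. v \<in> insert p A - {p} \<Longrightarrow> mpoly_eval h v = 0"
    by (rule linear_separator) auto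
  have "card (V - A) \<le> k * n + 1"
  proof -
    have "card (V - A) = card V - card A" using A(1) finA by (intro card_Diff_subset) auto
    moreover have "card (V - {p}) = card V - 1" using Suc.prems(2) fin by simp
    ultimately show ?thesis using A(2) Suc.prems(3) by auto
  qed
  then obtain g where g: "g \<in> forms k" "mpoly_eval g p = 1"
      "\<forall>v\<in>V - A - {p}. mpoly_eval g v = 0"
    using Suc.IH[of "V - A"] general_position_subset[OF Suc.prems(1)] Suc.prems(2) \<open>p \<notin> A\<close>
    by blast
  show ?case
  proof (intro bexI conjI ballI)
    show "h * g \<in> forms (Suc k)" using forms_mult[OF h(1) g(1)] by simp
    show "mpoly_eval (h * g) p = 1" using h g by simp
    show "mpoly_eval (h * g) v = 0" if "v \<in> V - {p}" for v
      using that h(3)[of v] g(3) \<open>p \<notin> A\<close> by (cases "v \<in> A") auto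
  qed
qed

text \<open>
  For \<open>m = 2\<close> the product is decomposable of the right degree, and for larger \<open>m\<close> it is
  one of the generators of low degree.
\<close>

lemma product_of_two_mem_generated_part:
  assumes "m \<ge> 2" "f \<in> forms 1" "g \<in> forms 1"
    and zero: "\<And>v. v \<in> V \<Longrightarrow> mpoly_eval f v = 0 \<or> mpoly_eval g v = 0"
  shows "f * g \<in> generated_part V m"
proof (cases "f = 0 \<or> g = 0")
  case True
  then show ?thesis using ideal.span_zero by auto
next
  case False
  have fg: "f * g \<in> forms 2" using forms_mult[OF assms(2,3)] by (simp add: numeral_2_eq_2)
  then have cone: "f * g \<in> cone_ideal V"
    using zero by (auto simp: form_mem_cone_ideal_iff)
  show ?thesis
  proof (cases "m = 2")
    case True
    define h where "h i = (if i = 0 then f else g)" for i :: nat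
    have "f * g = (\<Prod>i<m. h i)" "\<forall>i<m. h i \<in> forms 1 - {0}"
      using False assms(2,3) by (auto simp: h_def True numeral_2_eq_2)
    then have "f * g \<in> generating_forms V m"
      using fg cone unfolding generating_forms_def True by blast
    then show ?thesis by (rule ideal.span_base)
  next
    case False
    then show ?thesis using fg cone \<open>m \<ge> 2\<close> by (intro low_degree_mem_generated_part) auto
  qed
qed

lemma form_0_mem_cone_ideal:
  assumes "f \<in> forms 0" "f \<in> cone_ideal V" "V \<noteq> {}"
  shows "f = 0"
proof -
  obtain c where c: "f = const c" using assms(1) by (rule forms_0_const)
  then show ?thesis using assms(2,3) by (auto simp: form_mem_cone_ideal_iff[OF forms_const])
qed

section \<open>Generators of the ideal\<close>

text \<open>
  In coordinates that extend \<open>V\<close>, a form that vanishes on \<open>V\<close> has no pure powers of the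
  coordinates belonging to \<open>V\<close>.  The other coordinates are linear forms in the ideal, and
  products of two different coordinates are decomposable quadrics in the ideal.
\<close>

lemma cone_ideal_independent:
  fixes V :: "('k::field ^ 'v::finite) set"
  assumes inf: "infinite (UNIV :: 'k set)" and "m \<ge> 2" and V: "vec.independent V"
  shows "cone_ideal V \<subseteq> generated_part V m"
proof (rule cone_ideal_subset_if_forms[OF inf ideal.subspace_span])
  fix f :: "('k, 'v) mpoly" and l
  assume f: "f \<in> cone_ideal V" "f \<in> forms l"
  let ?B = "vec.extend_basis V"
  have B: "is_basis ?B" "V \<subseteq> ?B"
    using V by (auto intro: extend_basis_is_basis dest: vec.extend_basis_superset)
  have ev: "mpoly_eval (dual_form ?B b) v = (if b = v then 1 else 0)" if "v \<in> V" for b v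
    using B that by (auto simp: mpoly_eval_dual_form_basis)
  have dual: "dual_form ?B b \<in> generated_part V m" if "b \<in> ?B" "b \<notin> V" for b
  proof (rule low_degree_mem_generated_part[of _ _ 1])
    show "dual_form ?B b \<in> cone_ideal V"
      using that by (subst form_mem_cone_ideal_iff[of _ 1]) (auto simp: ev)
  qed (use \<open>m \<ge> 2\<close> in auto)
  show "f \<in> generated_part V m"
  proof (cases "l = 0")
    case True
    then show ?thesis using f \<open>m \<ge> 2\<close> by (intro low_degree_mem_generated_part) auto
  next
    case False
    show ?thesis
    proof (rule form_mem_ideal_of_mixed_products[OF B(1) ideal.subspace_span f(2)])
      fix b assume "b \<in> ?B" "mpoly_eval f b \<noteq> 0"
      then show "dual_form ?B b \<in> generated_part V m"
        using f by (intro dual) (auto simp: form_mem_cone_ideal_iff)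
    next
      fix a b and q :: "('k, 'v) mpoly" assume ab: "a \<in> ?B" "b \<in> ?B" "a \<noteq> b"
      have "dual_form ?B a * dual_form ?B b \<in> generated_part V m"
        using ab \<open>m \<ge> 2\<close> by (intro product_of_two_mem_generated_part) (auto simp: ev)
      then show "dual_form ?B a * dual_form ?B b * q \<in> generated_part V m"
        by (subst mult.commute) (rule ideal.span_scale)
    qed (use False in auto)
  qed
qed

text \<open>
  For \<open>m = 2\<close> the points outside \<open>A\<close> need not be cut out by linear forms alone, so the general
  induction step does not reach this case.  Write \<open>A0 = V - A\<close>, which is independent.  Its ideal
  is generated by linear forms, whose products with \<open>h\<close> are among the generators, and by products
  \<open>y * z\<close> of two coordinates dual to points \<open>a\<close>, \<open>b\<close> of \<open>A0\<close>.  The cubic \<open>h * y * z\<close> is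
  the interesting one.  Since \<open>z\<close> vanishes at \<open>a\<close>, it is a combination of forms \<open>t p\<close>, \<open>p \<in> A\<close>,
  where \<open>t p\<close> vanishes at \<open>a\<close> and on \<open>A - {p}\<close>.  In \<open>h * y * t p\<close> the factor \<open>y\<close> may be
  replaced by a linear form \<open>s\<close> with the same values on \<open>A0\<close> that vanishes at \<open>p\<close> as well, because
  \<open>h * (y - s)\<close> is a generator; and then \<open>s * t p\<close> is a generator, too.
\<close>

lemma hyperplane_multiple_two:
  fixes V :: "('k::field ^ 'v::finite) set"
  assumes inf: "infinite (UNIV :: 'k set)" and n: "CARD('v) = n + 1"
    and V: "general_position V" "n < card V" "card V \<le> 2 * n"
    and A: "A \<subseteq> V" "card A = n"
    and h: "h \<in> forms 1" "\<And>v. v \<in> A \<Longrightarrow> mpoly_eval h v = 0"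
    and f: "f \<in> cone_ideal (V - A)"
  shows "h * f \<in> generated_part V 2"
proof -
  let ?J = "generated_part V 2"
  define A0 where "A0 = V - A"
  have finV: "finite V" using V(1) by (rule general_position_finite)
  have finA: "finite A" using A(1) finV finite_subset by blast
  have "card A0 = card V - n" unfolding A0_def using A finA by (simp add: card_Diff_subset)
  then have cardA0: "card A0 \<le> n" "card A0 > 0" using V by auto
  then have "A0 \<noteq> {}" by auto
  have indA0: "vec.independent A0"
    by (rule general_position_independent[OF V(1)]) (use cardA0 n A0_def in auto)
  have two: "g1 * g2 \<in> ?J" if "g1 \<in> forms 1" "g2 \<in> forms 1"
    "\<And>v. v \<in> V \<Longrightarrow> mpoly_eval g1 v = 0 \<or> mpoly_eval g2 v = 0" for g1 g2
    using that by (intro product_of_two_mem_generated_part) auto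
  let ?B = "vec.extend_basis A0"
  have B: "is_basis ?B" "A0 \<subseteq> ?B"
    using indA0 by (auto intro: extend_basis_is_basis dest: vec.extend_basis_superset)
  have ev: "mpoly_eval (dual_form ?B b) v = (if b = v then 1 else 0)" if "v \<in> A0" for b v
    using B that by (auto simp: mpoly_eval_dual_form_basis)
  let ?K = "{f. h * f \<in> ?J}"
  have K: "ideal.subspace ?K" by (intro ideal_subspace_vimage_mult ideal.subspace_span)
  have dual: "dual_form ?B b \<in> ?K" if "b \<in> ?B" "b \<notin> A0" for b
  proof -
    have "mpoly_eval h v = 0 \<or> mpoly_eval (dual_form ?B b) v = 0" if "v \<in> V" for v
    proof (cases "v \<in> A0")
      case True
      then have "b \<noteq> v" using \<open>b \<notin> A0\<close> by blast
      then show ?thesis by (simp add: ev[OF True])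
    next
      case False
      then show ?thesis using that h(2) A0_def by blast
    qed
    then have "h * dual_form ?B b \<in> ?J" by (intro two h(1)) auto
    then show ?thesis by simp
  qed
  have mixed: "h * (dual_form ?B a * dual_form ?B b) \<in> ?J" if ab: "a \<in> A0" "b \<in> A0" "a \<noteq> b" for a b
  proof -
    let ?C = "insert a A"
    have "a \<notin> A" "a \<in> V" using ab A0_def by auto
    have C: "is_basis ?C"
      by (intro is_basis_if_card general_position_independent[OF V(1)])
        (use A n finA \<open>a \<notin> A\<close> \<open>a \<in> V\<close> in auto)
    let ?y = "dual_form ?B a" and ?z = "dual_form ?B b" and ?t = "dual_form ?C"
    have "?z = (\<Sum>p\<in>?C. const (mpoly_eval ?z p) * ?t p)"
      by (rule linear_form_expansion[OF C]) simp
    also have "\<dots> = (\<Sum>p\<in>A. const (mpoly_eval ?z p) * ?t p)"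
      using finA \<open>a \<notin> A\<close> ab by (simp add: ev)
    finally have z: "?z = (\<Sum>p\<in>A. const (mpoly_eval ?z p) * ?t p)" .
    have t: "h * (?y * ?t p) \<in> ?J" if "p \<in> A" for p
    proof -
      have "vec.independent (insert p A0)"
        by (rule general_position_independent[OF V(1)])
          (use cardA0 n A that A0_def finV in \<open>auto simp: card_insert_if\<close>)
      then obtain s where s: "s \<in> forms 1" "mpoly_eval s a = 1"
        "\<And>v. v \<in> insert p A0 - {a} \<Longrightarrow> mpoly_eval s v = 0"
        using ab by (auto elim: linear_separator[of _ a])
      have "h * (?y - s) \<in> ?J"
      proof (rule two)
        show "mpoly_eval h v = 0 \<or> mpoly_eval (?y - s) v = 0" if "v \<in> V" for v
        proof (cases "v \<in> A0")
          case True
          then show ?thesis using s(2) s(3)[of v] by (auto simp: ev[OF True])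
        next
          case False
          then show ?thesis using that h(2) A0_def by blast
        qed
      qed (use h(1) s(1) in auto)
      moreover have "s * ?t p \<in> ?J"
      proof (rule two)
        fix v assume "v \<in> V"
        then consider "v = a" | "v = p" | "v \<in> A" "v \<noteq> p" | "v \<in> A0" "v \<noteq> a"
          unfolding A0_def by blast
        then show "mpoly_eval s v = 0 \<or> mpoly_eval (?t p) v = 0"
        proof cases
          case 1
          have "a \<noteq> p" using that \<open>a \<notin> A\<close> by blast
          then show ?thesis using 1 by (simp add: mpoly_eval_dual_form_basis[OF C])
        next
          case 2
          have "a \<noteq> p" using that \<open>a \<notin> A\<close> by blast
          then show ?thesis using 2 s(3) by auto
        next
          case 3
          then show ?thesis by (simp add: mpoly_eval_dual_form_basis[OF C])
        next
          case 4
          then show ?thesis using s(3) by auto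
        qed
      qed (use s in auto)
      ultimately have "?t p * (h * (?y - s)) + h * (s * ?t p) \<in> ?J"
        by (intro ideal.span_add ideal.span_scale[of "h * (?y - s)"] ideal.span_scale[of "s * ?t p"])
      moreover have "?t p * (h * (?y - s)) + h * (s * ?t p) = h * (?y * ?t p)"
        by (simp add: right_diff_distrib mult_ac)
      ultimately show ?thesis by (simp only:)
    qed
    have "h * (?y * ?z) = h * (?y * (\<Sum>p\<in>A. const (mpoly_eval ?z p) * ?t p))"
      using z by (rule arg_cong)
    also have "\<dots> = (\<Sum>p\<in>A. const (mpoly_eval ?z p) * (h * (?y * ?t p)))"
      by (simp add: sum_distrib_left mult.left_commute)
    also have "\<dots> \<in> ?J" by (rule ideal.span_sum, rule ideal.span_scale, rule t)
    finally show ?thesis .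
  qed
  have "cone_ideal A0 \<subseteq> ?K"
  proof (rule cone_ideal_subset_if_forms[OF inf K])
    fix g :: "('k, 'v) mpoly" and l
    assume g: "g \<in> cone_ideal A0" "g \<in> forms l"
    show "g \<in> ?K"
    proof (cases "l = 0")
      case True
      then have "g = 0" using g \<open>A0 \<noteq> {}\<close> form_0_mem_cone_ideal by blast
      then show ?thesis using ideal.span_zero by simp
    next
      case False
      show ?thesis
      proof (rule form_mem_ideal_of_mixed_products[OF B(1) K g(2)])
        fix b assume "b \<in> ?B" "mpoly_eval g b \<noteq> 0"
        then show "dual_form ?B b \<in> ?K"
          using g by (intro dual) (auto simp: form_mem_cone_ideal_iff)
      next
        fix a b and q :: "('k, 'v) mpoly" assume ab: "a \<in> ?B" "b \<in> ?B" "a \<noteq> b"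
        consider "a \<in> A0" "b \<in> A0" | "b \<notin> A0" | "a \<notin> A0" by blast
        then have "dual_form ?B a * dual_form ?B b \<in> ?K"
        proof cases
          case 1
          then show ?thesis using mixed ab(3) by simp
        next
          case 2
          then show ?thesis by (intro ideal.subspace_scale[OF K] dual ab)
        next
          case 3
          then show ?thesis
            by (subst mult.commute) (intro ideal.subspace_scale[OF K] dual ab)
        qed
        then show "dual_form ?B a * dual_form ?B b * q \<in> ?K"
          by (subst mult.commute) (rule ideal.subspace_scale[OF K])
      qed (use False in auto)
    qed
  qed
  then show ?thesis using f unfolding A0_def by auto
qed

text \<open>
  Fix \<open>n\<close> points \<open>A\<close> and the hyperplane \<open>h\<close> through them, and let \<open>A0\<close> be the other points.
  Modulo \<open>h\<close> the ideal of \<open>V\<close> is contained in the ideal of the \<open>n\<close> coordinate points \<open>A\<close>, which is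
  spanned by the words with two different letters.  The point is to reach all such words of
  degree \<open>m\<close>, and this is the claim \<open>dual_multiple\<close> below: if \<open>f\<close> of degree \<open>m - 1\<close> vanishes
  at \<open>b \<in> A\<close>, then its product with the coordinate \<open>y\<close> of \<open>b\<close> is in the ideal generated by \<open>h\<close> and
  the chosen generators.

  Modulo \<open>h\<close>, the form \<open>y\<close> agrees, after scaling, with a hyperplane \<open>s\<close> through \<open>A - {b}\<close> and one further point \<open>v\<close>
  of \<open>A0\<close>, for every choice of \<open>v\<close>.  So \<open>y * f'\<close> is fine whenever \<open>f'\<close> vanishes on \<open>A0 - {v}\<close>
  and at \<open>b\<close>, for then \<open>s * f'\<close> is a multiple of a hyperplane through \<open>n\<close> points by a form through
  the others.  As the points of \<open>A0\<close> together with \<open>b\<close> impose independent conditions in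
  degree \<open>m - 1\<close>, every \<open>f\<close> that vanishes at \<open>b\<close> is a sum of such forms \<open>f'\<close>, with varying \<open>v\<close>.
\<close>

lemma cone_ideal_by_hyperplane_multiples:
  fixes V :: "('k::field ^ 'v::finite) set"
  assumes inf: "infinite (UNIV :: 'k set)" and n: "CARD('v) = n + 1" and "n \<ge> 1"
    and V: "general_position V" "n < card V" "card V \<le> m * n" and "m \<ge> 2"
    and multiple: "\<And>A h f. A \<subseteq> V \<Longrightarrow> card A = n \<Longrightarrow> h \<in> forms 1 \<Longrightarrow>
      (\<And>v. v \<in> A \<Longrightarrow> mpoly_eval h v = 0) \<Longrightarrow> f \<in> cone_ideal (V - A) \<Longrightarrow>
      h * f \<in> generated_part V m"
  shows "cone_ideal V \<subseteq> generated_part V m"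
proof -
  let ?J = "generated_part V m"
  have finV: "finite V" using V(1) by (rule general_position_finite)
  obtain A where A: "A \<subseteq> V" "card A = n"
    using V(2) by (meson less_imp_le obtain_subset_with_card_n)
  have finA: "finite A" using A(1) finV finite_subset by blast
  define A0 where "A0 = V - A"
  have cardA0: "card A0 = card V - n" unfolding A0_def using A finA by (simp add: card_Diff_subset)
  have finA0: "finite A0" unfolding A0_def using finV by blast
  obtain q where q: "q \<in> A0" using cardA0 V(2) by fastforce
  have basis: "is_basis (insert v A)" if "v \<in> A0" for v
    by (intro is_basis_if_card general_position_independent[OF V(1)])
      (use A n finA that A0_def in auto)
  let ?B = "insert q A"
  have B: "is_basis ?B" using basis q by blast
  note ev = mpoly_eval_dual_form_basis[OF B]
  have "q \<notin> A" using q A0_def by blast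
  let ?h = "dual_form ?B q"
  have h_A: "mpoly_eval ?h v = 0" if "v \<in> A" for v
    using that \<open>q \<notin> A\<close> by (auto simp: ev)
  have h_A0: "mpoly_eval ?h v \<noteq> 0" if "v \<in> A0" for v
  proof
    assume "mpoly_eval ?h v = 0"
    then have "?h = 0"
      using basis[OF that] h_A
      by (intro linear_form_zero_if_zero_on_spanning_set[of _ "insert v A"]) (auto simp: is_basis_def)
    then have "mpoly_eval ?h q = 0" by simp
    then show False by (simp add: ev)
  qed
  \<comment> \<open>computing modulo \<open>h\<close>\<close>
  let ?K = "ideal_generated (insert ?h (generating_forms V m))"
  have K: "ideal.subspace ?K" by (rule ideal.subspace_span)
  have J_K: "?J \<subseteq> ?K" by (rule ideal.span_mono) blast
  have h_K: "r * ?h \<in> ?K" for r by (intro ideal.span_scale ideal.span_base) blast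
  \<comment> \<open>a linear form that vanishes on \<open>A\<close> is a multiple of \<open>h\<close>\<close>
  have trace: "l \<in> ?K" if "l \<in> forms 1" "\<And>v. v \<in> A \<Longrightarrow> mpoly_eval l v = 0" for l
  proof -
    have "l = (\<Sum>b\<in>?B. const (mpoly_eval l b) * dual_form ?B b)"
      by (rule linear_form_expansion[OF B that(1)])
    also have "\<dots> = const (mpoly_eval l q) * ?h"
      using that(2) finA \<open>q \<notin> A\<close> by simp
    finally have "l = const (mpoly_eval l q) * ?h" .
    then show ?thesis using h_K[of "const (mpoly_eval l q)"] by (simp only:)
  qed
  have dual_multiple: "dual_form ?B b * f \<in> ?K"
    if b: "b \<in> A" and f: "f \<in> forms (m - 1)" "mpoly_eval f b = 0" for b and f :: "('k, 'v) mpoly"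
  proof -
    let ?y = "dual_form ?B b" and ?W = "insert b A0"
    have "b \<notin> A0" using b A0_def by blast
    have W: "general_position ?W" "card ?W \<le> (m - 1) * n + 1"
      using general_position_subset[OF V(1), of ?W] A(1) b finA0 \<open>b \<notin> A0\<close> cardA0 V(2,3) \<open>m \<ge> 2\<close>
      by (auto simp: A0_def diff_mult_distrib)
    have "\<forall>v\<in>A0. \<exists>g. g \<in> forms (m - 1) \<and> mpoly_eval g v = 1 \<and>
        (\<forall>u\<in>?W - {v}. mpoly_eval g u = 0)"
      using form_separator[OF n W(1) _ W(2)] by blast
    from bchoice[OF this]
    obtain g where g: "\<And>v. v \<in> A0 \<Longrightarrow> g v \<in> forms (m - 1)"
        "\<And>v. v \<in> A0 \<Longrightarrow> mpoly_eval (g v) v = 1"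
        "\<And>v u. v \<in> A0 \<Longrightarrow> u \<in> ?W - {v} \<Longrightarrow> mpoly_eval (g v) u = 0"
      by blast
    have exchange: "?y * f' \<in> ?K"
      if v: "v \<in> A0" and f': "f' \<in> forms (m - 1)" "\<And>u. u \<in> ?W - {v} \<Longrightarrow> mpoly_eval f' u = 0"
      for v and f' :: "('k, 'v) mpoly"
    proof -
      let ?A' = "insert v (A - {b})"
      have "v \<notin> A" using v A0_def by blast
      have "is_basis (insert v A)" using basis v by blast
      then obtain s where s: "s \<in> forms 1" "mpoly_eval s b = 1"
          "\<And>u. u \<in> insert v A - {b} \<Longrightarrow> mpoly_eval s u = 0"
        using linear_separator[of "insert v A" b] b by (auto simp: is_basis_def)
      have "card ?A' = n"
        using A(2) b finA \<open>v \<notin> A\<close> \<open>n \<ge> 1\<close> by (simp add: card_Diff_singleton)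
      moreover have "mpoly_eval s u = 0" if "u \<in> ?A'" for u
        using that b \<open>v \<notin> A\<close> by (intro s(3)) auto
      moreover have "f' \<in> cone_ideal (V - ?A')"
        unfolding form_mem_cone_ideal_iff[OF f'(1)] using f'(2) by (auto simp: A0_def)
      ultimately have "s * f' \<in> ?K"
        using multiple[of ?A' s f'] J_K s(1) A(1) v A0_def by auto
      moreover have "?y - s \<in> ?K"
      proof (rule trace)
        fix u assume "u \<in> A"
        then show "mpoly_eval (?y - s) u = 0"
          using s(2) s(3)[of u] by (cases "u = b") (auto simp: ev)
      qed (use s(1) in auto)
      ultimately have "f' * (?y - s) + s * f' \<in> ?K"
        by (intro ideal.span_add ideal.span_scale[of "?y - s"])
      moreover have "f' * (?y - s) + s * f' = ?y * f'"
        by (simp add: right_diff_distrib mult.commute)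
      ultimately show ?thesis by (simp only:)
    qed
    \<comment> \<open>interpolation: \<open>f0\<close> also vanishes on all of \<open>A0\<close>, so that any point of \<open>A0\<close> will do for it\<close>
    define f0 where "f0 = f - (\<Sum>v\<in>A0. const (mpoly_eval f v) * g v)"
    have "?y * f0 \<in> ?K"
    proof (rule exchange[OF q])
      show "f0 \<in> forms (m - 1)"
        unfolding f0_def using f g by (intro forms_diff forms_sum forms_const_mult)
      fix u assume "u \<in> ?W - {q}"
      then consider "u = b" | "u \<in> A0" by blast
      then show "mpoly_eval f0 u = 0"
      proof cases
        case 1
        have "mpoly_eval (g v) b = 0" if "v \<in> A0" for v
          using g(3)[OF that] that \<open>b \<notin> A0\<close> by blast
        then show ?thesis using f 1 by (simp add: f0_def)
      next
        case 2
        have "(\<Sum>v\<in>A0. mpoly_eval f v * mpoly_eval (g v) u) =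
            (\<Sum>v\<in>A0. if v = u then mpoly_eval f v else 0)"
          using 2 g(2,3) by (intro sum.cong) auto
        then show ?thesis using 2 finA0 by (simp add: f0_def)
      qed
    qed
    moreover have "(\<Sum>v\<in>A0. const (mpoly_eval f v) * (?y * g v)) \<in> ?K"
      by (rule ideal.span_sum, rule ideal.span_scale, rule exchange) (use g in auto)
    ultimately have "?y * f0 + (\<Sum>v\<in>A0. const (mpoly_eval f v) * (?y * g v)) \<in> ?K"
      by (rule ideal.span_add)
    moreover have "?y * f = ?y * f0 + (\<Sum>v\<in>A0. const (mpoly_eval f v) * (?y * g v))"
      by (simp add: f0_def right_diff_distrib sum_distrib_left mult.left_commute)
    ultimately show ?thesis by (simp only:)
  qed
  have mixed: "dual_form ?B a * dual_form ?B b * p \<in> ?K"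
    if ab: "a \<in> ?B" "b \<in> ?B" "a \<noteq> b" and p: "p \<in> forms (m - 2)" for a b and p :: "('k, 'v) mpoly"
  proof -
    consider "a = q" | "b = q" | "a \<in> A" using ab by blast
    then show ?thesis
    proof cases
      case 1
      then show ?thesis using h_K[of "dual_form ?B b * p"] by (simp add: mult_ac)
    next
      case 2
      then show ?thesis using h_K[of "dual_form ?B a * p"] by (simp add: mult_ac)
    next
      case 3
      have "Suc (m - 2) = m - 1" using \<open>m \<ge> 2\<close> by simp
      then have "dual_form ?B b * p \<in> forms (m - 1)"
        using forms_mult[OF dual_form_in_forms p, of ?B b] by simp
      moreover have "mpoly_eval (dual_form ?B b * p) a = 0" using ab by (simp add: ev)
      ultimately show ?thesis using dual_multiple[OF 3] by (simp add: mult.assoc)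
    qed
  qed
  show ?thesis
  proof (rule cone_ideal_subset_if_forms[OF inf ideal.subspace_span])
    fix f :: "('k, 'v) mpoly" and l
    assume f: "f \<in> cone_ideal V" "f \<in> forms l"
    show "f \<in> ?J"
    proof (cases "l < m")
      case True
      then show ?thesis using f by (intro low_degree_mem_generated_part)
    next
      case False
      have "f \<in> ?K"
      proof (rule form_mem_ideal_of_mixed_products[OF B K f(2)])
        show "l \<ge> 1" using False \<open>m \<ge> 2\<close> by simp
        show "dual_form ?B b \<in> ?K" if "b \<in> ?B" "mpoly_eval f b \<noteq> 0" for b
          using that f A q A0_def by (auto simp: form_mem_cone_ideal_iff)
        show "dual_form ?B a * dual_form ?B b * p \<in> ?K"
          if "a \<in> ?B" "b \<in> ?B" "a \<noteq> b" "p \<in> forms (l - 2)" for a b and p :: "('k, 'v) mpoly"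
          by (rule form_multiples_mem_ideal_mono[OF B K mixed[OF that(1-3)] _ that(4)])
            (use False in auto)
      qed
      \<comment> \<open>the pure powers drop out because \<open>f\<close> vanishes on \<open>A\<close> and at \<open>q\<close>; what is left is a
        multiple of \<open>h\<close>, and \<open>h\<close> has no zero among the points of \<open>A0\<close>\<close>
      then obtain r where r: "f - r * ?h \<in> ?J" by (auto simp: ideal.span_insert)
      have "r \<in> cone_ideal A0"
        unfolding cone_ideal_def mem_Collect_eq
      proof (intro ballI allI impI)
        fix v and c :: 'k assume v: "v \<in> A0" "c \<noteq> 0"
        then have "v \<in> V" using A0_def by blast
        have "f - r * ?h \<in> cone_ideal V" using r generated_part_subset by blast
        then have "mpoly_eval (f - r * ?h) (c *s v) = 0"
          unfolding cone_ideal_def using \<open>v \<in> V\<close> v(2) by blast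
        moreover have "mpoly_eval f (c *s v) = 0"
          using f(1) \<open>v \<in> V\<close> v(2) unfolding cone_ideal_def by blast
        ultimately have "mpoly_eval r (c *s v) * mpoly_eval ?h (c *s v) = 0" by simp
        moreover have "mpoly_eval ?h (c *s v) \<noteq> 0"
          using h_A0[OF v(1)] v(2) by (simp add: mpoly_eval_scale_form[OF dual_form_in_forms])
        ultimately show "mpoly_eval r (c *s v) = 0" by simp
      qed
      then have "?h * r \<in> ?J"
        using A h_A by (intro multiple[of A]) (auto simp: A0_def)
      then have "(f - r * ?h) + ?h * r \<in> ?J" using r by (intro ideal.span_add)
      then show ?thesis by (simp add: mult.commute)
    qed
  qed
qed

text \<open>
  Induction on \<open>m\<close>: removing the \<open>n\<close> points of a hyperplane leaves at most \<open>(m - 1) * n\<close> points.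
\<close>

lemma cone_ideal_generated:
  fixes V :: "('k::field ^ 'v::finite) set"
  assumes inf: "infinite (UNIV :: 'k set)" and n: "CARD('v) = n + 1" and "n \<ge> 1"
    and "m \<ge> 2" "general_position V" "card V \<le> m * n"
  shows "cone_ideal V \<subseteq> generated_part V m"
  using assms(4-6)
proof (induction m arbitrary: V rule: less_induct)
  case (less m)
  note V = less.prems
  show ?case
  proof (cases "card V \<le> n")
    case True
    then have "vec.independent V"
      using general_position_independent[OF V(2)] n by simp
    then show ?thesis by (rule cone_ideal_independent[OF inf V(1)])
  next
    case False
    then have big: "n < card V" by simp
    show ?thesis
    proof (rule cone_ideal_by_hyperplane_multiples[OF inf n \<open>n \<ge> 1\<close> V(2) big V(3,1)])
      fix A and h f :: "('k, 'v) mpoly"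
      assume A: "A \<subseteq> V" "card A = n" and h: "h \<in> forms 1" "\<And>v. v \<in> A \<Longrightarrow> mpoly_eval h v = 0"
        and f: "f \<in> cone_ideal (V - A)"
      show "h * f \<in> generated_part V m"
      proof (cases "m = 2")
        case True
        then show ?thesis using hyperplane_multiple_two[OF inf n V(2) big _ A h f] V(3) by simp
      next
        case False
        have "finite A" using A(1) V(2) general_position_finite finite_subset by blast
        then have "card (V - A) \<le> (m - 1) * n"
          using A V(3) by (simp add: card_Diff_subset diff_mult_distrib)
        then have "cone_ideal (V - A) \<subseteq> generated_part (V - A) (m - 1)"
          using less.IH[of "m - 1" "V - A"] general_position_subset[OF V(2)] V(1) False by auto
        then show ?thesis using linear_multiple_mem_generated_part[OF V(1) h] f by blast
      qed
    qed
  qed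
qed

section \<open>From projective points to representatives\<close>

text \<open>
  If there are at least \<open>n + 1\<close> points, a small subset is first enlarged to \<open>n + 1\<close> points; as many
  spanning vectors as the dimension are independent.
\<close>

lemma representatives_general_position:
  fixes \<Gamma> :: "('k::field ^ 'v::finite) set set"
  assumes fin: "finite \<Gamma>" and lgp: "lin_general_position \<Gamma>"
    and r: "\<And>P. P \<in> \<Gamma> \<Longrightarrow> r P \<in> P"
    and reps: "\<And>P v. P \<in> \<Gamma> \<Longrightarrow> v \<in> P \<longleftrightarrow> (\<exists>c. c \<noteq> 0 \<and> v = c *s r P)"
    and inj: "inj_on r \<Gamma>"
  shows "general_position (r ` \<Gamma>)"
  unfolding general_position_def
proof (intro conjI allI impI)
  show "finite (r ` \<Gamma>)" using fin by simp
  fix T assume T: "T \<subseteq> r ` \<Gamma>" "card T \<le> CARD('v)"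
  show "vec.independent T"
  proof (cases "CARD('v) \<le> card \<Gamma>")
    case False
    then have "vec.independent (r ` \<Gamma>)"
      using lgp r by (simp add: lin_general_position_def lin_indep_points_def)
    then show ?thesis using T(1) vec.independent_mono by blast
  next
    case True
    have "finite T" using T(1) fin finite_subset by blast
    obtain U where U: "T \<subseteq> U" "U \<subseteq> r ` \<Gamma>" "card U = CARD('v)"
      using exists_subset_between[of T "CARD('v)" "r ` \<Gamma>"] T True fin card_image[OF inj] by auto
    obtain S where S: "S \<subseteq> \<Gamma>" "U = r ` S" using U(2) by (auto simp: subset_image_iff)
    have "card S = CARD('v)" using U(3) S(2) card_image[OF inj_on_subset[OF inj S(1)]] by simp
    then have sp: "vec.span (\<Union>S) = UNIV"
      using lgp True S(1) by (simp add: lin_general_position_def)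
    have "\<Union>S \<subseteq> vec.span U"
    proof
      fix v assume "v \<in> \<Union>S"
      then obtain P c where P: "P \<in> S" "v = c *s r P" using reps S(1) by blast
      then have "r P \<in> U" using S(2) by blast
      then show "v \<in> vec.span U" unfolding P(2) by (intro vec.span_scale vec.span_base)
    qed
    then have "UNIV \<subseteq> vec.span U" using sp vec.span_minimal[OF _ vec.subspace_span] by blast
    moreover have "finite U" using U(2) fin finite_subset by blast
    ultimately have "vec.independent U"
      using vec.card_le_dim_spanning[of U UNIV, unfolded vec_dim_card] U(3) by simp
    then show ?thesis using U(1) vec.independent_mono by blast
  qed
qed

lemma proj_point_representative:
  assumes "P \<in> proj_space"
  shows "\<exists>u. u \<in> P \<and> (\<forall>v. v \<in> P \<longleftrightarrow> (\<exists>c. c \<noteq> 0 \<and> v = c *s u))"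
proof -
  from assms obtain u where u: "u \<noteq> 0" "P = proportional `` {u}"
    unfolding proj_space_def by (auto elim: quotientE)
  show ?thesis
  proof (rule exI[of _ u], intro conjI allI)
    show "u \<in> P"
      using u by (auto simp: proportional_def intro!: exI[of _ 1])
    show "v \<in> P \<longleftrightarrow> (\<exists>c. c \<noteq> 0 \<and> v = c *s u)" for v
      using u by (auto simp: proportional_def)
  qed
qed

theorem theorem1p2:
  fixes \<Gamma> :: "('k::alg_closed_field ^ 'v) set set"
    and m n d :: nat
  assumes "m \<ge> 2" and "n \<ge> 1"
    and "CARD('v) = n + 1"
    and "\<Gamma> \<subseteq> proj_space"
    and "finite \<Gamma>" and "card \<Gamma> = d"
    and "lin_general_position \<Gamma>"
    and "d \<le> m * n"
  shows "vanishing_ideal \<Gamma> =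
           ideal_generated (vanishing_forms_upto \<Gamma> (m - 1) \<union> decomposable_vanishing_forms \<Gamma> m)
         \<and> (\<exists>G \<subseteq> (\<Union>j\<le>m. forms j). vanishing_ideal \<Gamma> = ideal_generated G)"
proof -
  define r where "r P = (SOME u. u \<in> P \<and> (\<forall>v. v \<in> P \<longleftrightarrow> (\<exists>c. c \<noteq> 0 \<and> v = c *s u)))"
    for P :: "('k ^ 'v) set"
  have r_reps: "r P \<in> P \<and> (\<forall>v. v \<in> P \<longleftrightarrow> (\<exists>c. c \<noteq> 0 \<and> v = c *s r P))" if "P \<in> \<Gamma>" for P
    unfolding r_def by (rule someI_ex, rule proj_point_representative, rule subsetD[OF assms(4) that])
  have r: "r P \<in> P" if "P \<in> \<Gamma>" for P
    using r_reps[OF that] by (rule conjunct1)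
  have reps: "v \<in> P \<longleftrightarrow> (\<exists>c. c \<noteq> 0 \<and> v = c *s r P)" if "P \<in> \<Gamma>" for P v
    using r_reps[OF that] by blast
  let ?V = "r ` \<Gamma>"
  have inj: "inj_on r \<Gamma>"
  proof (rule inj_onI)
    fix P Q assume PQ: "P \<in> \<Gamma>" "Q \<in> \<Gamma>" "r P = r Q"
    then have "v \<in> P \<longleftrightarrow> v \<in> Q" for v using reps[of P v] reps[of Q v] by simp
    then show "P = Q" by blast
  qed
  have "general_position ?V"
    by (rule representatives_general_position[OF assms(5,7) r reps inj])
  moreover have "card ?V \<le> m * n" using assms(6,8) card_image[OF inj] by simp
  ultimately have "cone_ideal ?V \<subseteq> generated_part ?V m"
    by (rule cone_ideal_generated[OF infinite_alg_closed_field assms(3,2,1)])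
  then have eq: "cone_ideal ?V = generated_part ?V m" using generated_part_subset by blast
  let ?G = "vanishing_forms_upto \<Gamma> (m - 1) \<union> decomposable_vanishing_forms \<Gamma> m"
  have van: "vanishing_ideal \<Gamma> = cone_ideal ?V"
    unfolding vanishing_ideal_def cone_ideal_def using reps by auto
  have G: "?G = generating_forms ?V m"
    unfolding vanishing_forms_upto_def decomposable_vanishing_forms_def vanishing_forms_def
      generating_forms_def van ..
  have "?G \<subseteq> (\<Union>j\<le>m. forms j)"
    unfolding G generating_forms_def by fastforce
  moreover have "vanishing_ideal \<Gamma> = ideal_generated ?G"
    unfolding van G by (rule eq)
  ultimately show ?thesis by blast
qed

end
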